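(* Let $q$ be a prime power, let $m\ge 1$ and $n\ge 3$ be integers, let $h$ be a non-negative integer, and let $X$ be a vector space of dimension $n$ over $\mathbb{F}_{q^m}$. Let $\mathcal{D}=\{\langle x\rangle_{\mathbb{F}_{q^m}} : x\in X\setminus\{0\}\}$. If $U$ is a $(\mathcal{D},h)$-evasive $\mathbb{F}_q$-subspace of $X$ having $\mathbb{F}_q$-dimension $(n-2)m+h+1$, then $L_U$ is a linear $2$-cutting blocking set in $X$.
   Context: An $\mathbb{F}_q$-subspace $U\le X$ is $(\mathcal{D},h)$-evasive if $\dim_{\mathbb{F}_q}(U\cap S)\leq h$ for all $S\in\mathcal{D}$. For an $\mathbb{F}_q$-subspace $U\le X$, the $\mathbb{F}_q$-linear set defined by $U$ is $L_U=\{\langle u\rangle_{\mathbb{F}_{q^m}}: u\in U\setminus\{0\}\}$, and its rank is $\dim_{\mathbb{F}_q}(U)$. For a positive integer $r<n$, an $r$-blocking set in $X$ is a set $\mathcal{B}$ of one-dimensional $\mathbb{F}_{q^m}$-subspaces of $X$ such that every $(n-r)$-dimensional $\mathbb{F}_{q^m}$-subspace $\mathcal{S}$ of $X$ contains at least one element of $\mathcal{B}$. An $r$-blocking set $\mathcal{B}$ is $(n-r)$-cutting if for every pair $\mathcal{S},\mathcal{S}'$ of $(n-r)$-dimensional $\mathbb{F}_{q^m}$-subspaces of $X$ one has $\{B\in\mathcal{B}: B\leq\mathcal{S}\}\subseteq\{B\in\mathcal{B}: B\leq\mathcal{S}'\}$ if and only if $\mathcal{S}=\mathcal{S}'$. A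 linear $2$-cutting blocking set in $X$ is an $\mathbb{F}_q$-linear set $L_U$ that is an $(n-2)$-blocking set and is $2$-cutting. *)

theory Defs
  imports "HOL-Number_Theory.Prime_Powers" "HOL-Library.Cardinality"
begin

text \<open>
  Throughout, the ambient space \<open>X\<close> is the whole type \<open>'v\<close>, and a vector space structure on it
  is given by its scalar multiplication (locale \<^locale>\<open>vector_space\<close>). The field of order \<open>q\<close> is a
  type \<open>'k\<close>, the field of order \<open>q ^ m\<close> is a type \<open>'f\<close>, and the inclusion of the former in the
  latter is a field embedding. Below, \<open>sK\<close> stands for a \<open>'k\<close>-scalar multiplication and \<open>sF\<close> for
  an \<open>'f\<close>-scalar multiplication on \<open>X\<close>.
\<close>

definition field_embedding :: "('k::field \<Rightarrow> 'f::field) \<Rightarrow> bool" where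
  "field_embedding e \<longleftrightarrow>
     e 1 = 1 \<and> (\<forall>a b. e (a + b) = e a + e b) \<and> (\<forall>a b. e (a * b) = e a * e b)"

definition restrict_scalars ::
    "('k \<Rightarrow> 'f) \<Rightarrow> ('f \<Rightarrow> 'v \<Rightarrow> 'v) \<Rightarrow> 'k \<Rightarrow> 'v \<Rightarrow> 'v" where
  "restrict_scalars e sF = (\<lambda>c x. sF (e c) x)"

definition subspaces_of_dim ::
    "('f::field \<Rightarrow> 'v::ab_group_add \<Rightarrow> 'v) \<Rightarrow> nat \<Rightarrow> 'v set set" where
  "subspaces_of_dim sF k = {S. module.subspace sF S \<and> vector_space.dim sF S = k}"

definition points :: "('f::field \<Rightarrow> 'v::ab_group_add \<Rightarrow> 'v) \<Rightarrow> 'v set set" where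
  "points sF = {module.span sF {x} | x. x \<in> UNIV - {0}}"

definition evasive ::
    "('k::field \<Rightarrow> 'v::ab_group_add \<Rightarrow> 'v) \<Rightarrow> 'v set set \<Rightarrow> nat \<Rightarrow> 'v set \<Rightarrow> bool" where
  "evasive sK D h U \<longleftrightarrow>
     module.subspace sK U \<and> (\<forall>S\<in>D. vector_space.dim sK (U \<inter> S) \<le> h)"

definition linear_set ::
    "('f::field \<Rightarrow> 'v::ab_group_add \<Rightarrow> 'v) \<Rightarrow> 'v set \<Rightarrow> 'v set set" where
  "linear_set sF U = {module.span sF {u} | u. u \<in> U - {0}}"

definition blocking_set ::
    "('f::field \<Rightarrow> 'v::ab_group_add \<Rightarrow> 'v) \<Rightarrow> nat \<Rightarrow> 'v set set \<Rightarrow> bool" where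
  "blocking_set sF r B \<longleftrightarrow>
     0 < r \<and> r < vector_space.dim sF UNIV \<and>
     B \<subseteq> subspaces_of_dim sF 1 \<and>
     (\<forall>S \<in> subspaces_of_dim sF (vector_space.dim sF UNIV - r). \<exists>P\<in>B. P \<subseteq> S)"

text \<open>The parameter \<open>k\<close> is the dimension \<open>n - r\<close> when the set is an \<open>r\<close>-blocking set.\<close>

definition cutting ::
    "('f::field \<Rightarrow> 'v::ab_group_add \<Rightarrow> 'v) \<Rightarrow> nat \<Rightarrow> 'v set set \<Rightarrow> bool" where
  "cutting sF k B \<longleftrightarrow>
     (\<forall>S \<in> subspaces_of_dim sF k. \<forall>S' \<in> subspaces_of_dim sF k.
        {P\<in>B. P \<subseteq> S} \<subseteq> {P\<in>B. P \<subseteq> S'} \<longleftrightarrow> S = S')"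

definition linear_2_cutting_blocking_set ::
    "('k::field \<Rightarrow> 'v::ab_group_add \<Rightarrow> 'v) \<Rightarrow> ('f::field \<Rightarrow> 'v \<Rightarrow> 'v) \<Rightarrow> 'v set set \<Rightarrow> bool" where
  "linear_2_cutting_blocking_set sK sF B \<longleftrightarrow>
     (\<exists>U. module.subspace sK U \<and> B = linear_set sF U) \<and>
     blocking_set sF (vector_space.dim sF UNIV - 2) B \<and>
     cutting sF 2 B"

end

theory Submission
  imports Defs
begin

text \<open>
  Counting vectors instead of comparing dimensions: for a plane \<open>S\<close> the addition map \<open>U \<times> S \<rightarrow> X\<close> has
  fibres no larger than \<open>U \<inter> S\<close>, so \<open>U \<inter> S\<close> has at least \<open>q ^ (h + 1)\<close> elements. In
  particular it is nonzero, which gives the blocking property. If every point of \<open>L\<^sub>U\<close> in \<open>S\<close> also lies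
  in another plane \<open>S'\<close>, then \<open>U \<inter> S\<close> is contained in \<open>S \<inter> S'\<close>, hence in a single point, and
  evasiveness allows at most \<open>q ^ h\<close> vectors of \<open>U\<close> there.
\<close>

text \<open>Fix one pair (u, s) of the fibre. Any other pair (v, t) satisfies v - u = s - t, so this
  difference lies in both \<open>U\<close> and \<open>S\<close>, and it determines v and hence the
  whole pair.\<close>

lemma card_fibre_add_le:
  fixes U S :: "'a::ab_group_add set"
  assumes "finite U"
    and U: "\<And>u v. u \<in> U \<Longrightarrow> v \<in> U \<Longrightarrow> u - v \<in> U"
    and S: "\<And>u v. u \<in> S \<Longrightarrow> v \<in> S \<Longrightarrow> u - v \<in> S"
  shows "card {p \<in> U \<times> S. fst p + snd p = x} \<le> card (U \<inter> S)"
proof (cases "{p \<in> U \<times> S. fst p + snd p = x} = {}")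
  case True
  then show ?thesis by (metis card.empty zero_le)
next
  case False
  then obtain u s where us: "u \<in> U" "s \<in> S" "u + s = x" by auto
  show ?thesis
  proof (rule card_inj_on_le[where f = "\<lambda>p. fst p - u"])
    show "inj_on (\<lambda>p. fst p - u) {p \<in> U \<times> S. fst p + snd p = x}"
      by (auto simp: inj_on_def)
    have "v - u \<in> U \<inter> S" if "v \<in> U" "t \<in> S" "v + t = x" for v t
    proof -
      have "v - u = s - t" using that us by (simp add: algebra_simps)
      then show ?thesis using U[OF that(1) us(1)] S[OF us(2) that(2)] by simp
    qed
    then show "(\<lambda>p. fst p - u) ` {p \<in> U \<times> S. fst p + snd p = x} \<subseteq> U \<inter> S"
      by auto
  qed (use assms in simp)
qed

text \<open>Sum the fibre bound over all possible values in \<open>X\<close>. This replaces the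
  dimension formula for a sum of subspaces. Only the additive structure enters, so \<open>U\<close>
  and \<open>S\<close> may be subspaces over different fields.\<close>

lemma card_mult_le_card_Int:
  fixes U S X :: "'a::ab_group_add set"
  assumes "finite X" "U \<subseteq> X" "S \<subseteq> X"
    and X: "\<And>u v. u \<in> X \<Longrightarrow> v \<in> X \<Longrightarrow> u + v \<in> X"
    and U: "\<And>u v. u \<in> U \<Longrightarrow> v \<in> U \<Longrightarrow> u - v \<in> U"
    and S: "\<And>u v. u \<in> S \<Longrightarrow> v \<in> S \<Longrightarrow> u - v \<in> S"
  shows "card U * card S \<le> card X * card (U \<inter> S)"
proof -
  have fin: "finite U" "finite S" using finite_subset[OF _ \<open>finite X\<close>] assms(2,3) by blast+
  have "card U * card S = (\<Sum>p\<in>U \<times> S. 1)"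
    by (simp add: card_cartesian_product)
  also have "\<dots> = (\<Sum>x\<in>X. \<Sum>p\<in>{p \<in> U \<times> S. fst p + snd p = x}. 1)"
    by (rule sum.group[symmetric]) (use fin assms(1-3) X in \<open>auto simp: subset_iff\<close>)
  also have "\<dots> \<le> (\<Sum>x\<in>X. card (U \<inter> S))"
    using card_fibre_add_le[OF fin(1) U S] by (intro sum_mono) simp
  finally show ?thesis by simp
qed

context vector_space
begin

text \<open>Adjoining a vector \<open>a\<close> outside \<open>span B\<close> gives every element of
  the new span a unique form c a + x with x in \<open>span B\<close>, so the size is multiplied by
  the order of the field.\<close>

lemma card_span_independent:
  fixes B :: "'b set"
  assumes "finite B" "independent B"
  shows "card (span B) = CARD('a) ^ card B"
  using assms
proof (induction B rule: finite_induct)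
  case empty
  then show ?case by simp
next
  case (insert a B)
  then have a: "a \<notin> span B" and B: "independent B"
    by (auto simp: independent_insert)
  let ?f = "\<lambda>(c, x). scale c a + x"
  have "bij_betw ?f (UNIV \<times> span B) (span (insert a B))"
  proof (rule bij_betw_imageI)
    show "inj_on ?f (UNIV \<times> span B)"
    proof (rule inj_onI, clarsimp)
      fix c d x y
      assume xy: "x \<in> span B" "y \<in> span B" and eq: "scale c a + x = scale d a + y"
      then have "scale (c - d) a = y - x" by (simp add: algebra_simps)
      then have "scale (c - d) a \<in> span B" using xy span_diff by simp
      \<comment> \<open>Otherwise rescaling by the inverse of c - d would put \<open>a\<close> into
        \<open>span B\<close>.\<close>
      then have "c = d"
        using a span_scale[of "scale (c - d) a" B "inverse (c - d)"] by (cases "c = d") auto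
      then show "c = d \<and> x = y" using eq by simp
    qed
    show "?f ` (UNIV \<times> span B) = span (insert a B)"
    proof (intro equalityI subsetI)
      fix y assume "y \<in> span (insert a B)"
      then obtain c where "y - scale c a \<in> span B" by (auto simp: span_breakdown_eq)
      then show "y \<in> ?f ` (UNIV \<times> span B)"
        by (intro image_eqI[of _ _ "(c, y - scale c a)"]) auto
    qed (auto intro!: span_add span_scale intro: span_base span_mono[THEN subsetD])
  qed
  then have "card (span (insert a B)) = CARD('a) * card (span B)"
    by (simp add: bij_betw_same_card[symmetric] card_cartesian_product)
  then show ?case using insert B by simp
qed

lemma card_subspace:
  assumes "subspace W" "finite W"
  shows "card W = CARD('a) ^ dim W"
proof -
  obtain B where B: "B \<subseteq> W" "independent B" "W \<subseteq> span B" "card B = dim W"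
    using basis_exists by blast
  then have "span B = W" using assms span_minimal by blast
  then show ?thesis using card_span_independent[of B] B assms finite_subset by metis
qed

text \<open>Since \<open>card\<close> is 0 on infinite sets, a positive \<open>dim\<close> forces
  the chosen basis to be finite, so positivity encodes finite dimension here.\<close>

lemma finite_UNIV_of_dim_pos:
  assumes "finite (UNIV :: 'a set)" "dim UNIV > 0"
  shows "finite (UNIV :: 'b set)"
proof -
  obtain B :: "'b set" where B: "independent B" "UNIV \<subseteq> span B" "card B = dim UNIV"
    using basis_exists by blast
  then have "finite B" using assms(2) card_ge_0_finite by metis
  then have "card (UNIV :: 'b set) = CARD('a) ^ card B"
    using card_span_independent B by (metis top.extremum_uniqueI)
  moreover have "CARD('a) > 0" using assms(1) by (simp add: card_gt_0_iff)
  ultimately show ?thesis by (simp add: card_ge_0_finite)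
qed

lemma dim_span_singleton:
  assumes "x \<noteq> 0"
  shows "dim (span {x}) = 1"
  using assms dim_span_eq_card_independent[of "{x}"] by simp

end

lemma vector_space_restrict_scalars:
  assumes "field_embedding e" "vector_space sF"
  shows "vector_space (restrict_scalars e sF)"
proof -
  interpret vector_space sF by fact
  show ?thesis
    using assms(1) unfolding field_embedding_def restrict_scalars_def
    by unfold_locales (auto simp: algebra_simps)
qed

theorem theorem7p5:
  fixes q m n h :: nat
    and e :: "'k::field \<Rightarrow> 'f::field"
    and sF :: "'f \<Rightarrow> 'v::ab_group_add \<Rightarrow> 'v"
    and sK :: "'k \<Rightarrow> 'v \<Rightarrow> 'v"
    and D :: "'v set set"
    and U :: "'v set"
  assumes "primepow q" and "m \<ge> 1" and "n \<ge> 3"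
    and "CARD('k) = q" and "CARD('f) = q ^ m"
    and "field_embedding e"
    and "vector_space sF" and "vector_space.dim sF UNIV = n"
    and "sK = restrict_scalars e sF"
    and "D = points sF"
    and "evasive sK D h U"
    and "vector_space.dim sK U = (n - 2) * m + h + 1"
  shows "linear_2_cutting_blocking_set sK sF (linear_set sF U)"
proof -
  interpret F: vector_space sF by fact
  interpret K: vector_space sK
    unfolding \<open>sK = _\<close> by (rule vector_space_restrict_scalars) fact+
  have q: "q \<ge> 2" using \<open>primepow q\<close> primepow_gt_Suc_0 by fastforce
  have "finite (UNIV :: 'f set)"
    using q \<open>CARD('f) = q ^ m\<close> by (intro card_ge_0_finite) simp
  then have finX: "finite (UNIV :: 'v set)"
    using F.finite_UNIV_of_dim_pos \<open>F.dim UNIV = n\<close> \<open>n \<ge> 3\<close> by simp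
  have fin: "finite A" for A :: "'v set" by (rule finite_subset[OF subset_UNIV finX])
  have cardF: "card S = q ^ (m * F.dim S)" if "F.subspace S" for S
    using F.card_subspace[OF that fin] \<open>CARD('f) = q ^ m\<close> by (simp add: power_mult)
  have cardK: "card W = q ^ K.dim W" if "K.subspace W" for W
    using K.card_subspace[OF that fin] \<open>CARD('k) = q\<close> by simp
  have subK: "K.subspace S" if "F.subspace S" for S
    using that unfolding F.subspace_def K.subspace_def
    by (simp add: \<open>sK = _\<close> restrict_scalars_def)
  have U: "K.subspace U" using \<open>evasive sK D h U\<close> unfolding evasive_def by blast
  \<comment> \<open>Evasiveness concerns nonzero x only. The case x = 0 is included because two
    planes may meet in 0 alone.\<close>
  have point: "card (U \<inter> F.span {x}) \<le> q ^ h" for x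
  proof (cases "x = 0")
    case True
    then have "U \<inter> F.span {x} = {0}" using K.subspace_0[OF U] by auto
    then show ?thesis using q by simp
  next
    case False
    then have "K.dim (U \<inter> F.span {x}) \<le> h"
      using \<open>evasive sK D h U\<close> unfolding evasive_def \<open>D = _\<close> points_def by blast
    then show ?thesis
      using cardK K.subspace_inter[OF U subK[OF F.subspace_span]] q by (simp add: power_increasing)
  qed
  have plane: "card (U \<inter> S) \<ge> q ^ (h + 1)" if "F.subspace S" "F.dim S = 2" for S
  proof -
    have "card U * card S \<le> card (UNIV :: 'v set) * card (U \<inter> S)"
      using U that by (intro card_mult_le_card_Int fin K.subspace_diff F.subspace_diff) auto
    moreover have "card U * card S = q ^ (n * m) * q ^ (h + 1)"
    proof -
      \<comment> \<open>A plane has q^(2m) vectors, and these 2m exponents complete (n - 2)m to nm.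
        The surplus h + 1 is what remains after cancelling the size of the ambient space.\<close>
      have "(n - 2) * m + h + 1 + m * 2 = n * m + (h + 1)"
        using le_Suc_ex[OF \<open>n \<ge> 3\<close>] by (auto simp: algebra_simps)
      then show ?thesis
        unfolding cardK[OF U] cardF[OF that(1)] that(2) \<open>K.dim U = _\<close> power_add[symmetric] by (rule arg_cong)
    qed
    moreover have "card (UNIV :: 'v set) = q ^ (n * m)"
      using cardF[OF F.subspace_UNIV] \<open>F.dim UNIV = n\<close> by (simp add: mult.commute)
    ultimately show ?thesis using q by simp
  qed
  have "blocking_set sF (n - 2) (linear_set sF U)"
    unfolding blocking_set_def
  proof (intro conjI ballI)
    show "linear_set sF U \<subseteq> subspaces_of_dim sF 1"
      unfolding linear_set_def subspaces_of_dim_def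
      using F.dim_span_singleton F.subspace_span by auto
    fix S assume "S \<in> subspaces_of_dim sF (F.dim UNIV - (n - 2))"
    then have S: "F.subspace S" "F.dim S = 2"
      using \<open>F.dim UNIV = n\<close> \<open>n \<ge> 3\<close> unfolding subspaces_of_dim_def by auto
    \<comment> \<open>The exponent is positive even for h = 0, so \<open>U \<inter> S\<close>
      contains more than the zero vector.\<close>
    have "(1::nat) < q ^ (h + 1)" using q by (intro one_less_power) auto
    then have "\<not> U \<inter> S \<subseteq> {0}"
      using plane[OF S] card_mono[of "{0}" "U \<inter> S"] by auto
    then obtain u where "u \<in> U" "u \<in> S" "u \<noteq> 0" by blast
    then show "\<exists>P\<in>linear_set sF U. P \<subseteq> S"
      using F.span_minimal[of "{u}" S] S unfolding linear_set_def by blast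
  qed (use \<open>F.dim UNIV = n\<close> \<open>n \<ge> 3\<close> in auto)
  moreover have "cutting sF 2 (linear_set sF U)"
    unfolding cutting_def
  proof (intro ballI iffI)
    fix S S'
    assume "S \<in> subspaces_of_dim sF 2" "S' \<in> subspaces_of_dim sF 2"
      and sub: "{P \<in> linear_set sF U. P \<subseteq> S} \<subseteq> {P \<in> linear_set sF U. P \<subseteq> S'}"
    then have S: "F.subspace S" "F.dim S = 2" and S': "F.subspace S'" "F.dim S' = 2"
      unfolding subspaces_of_dim_def by auto
    have US: "U \<inter> S \<subseteq> S'"
    proof
      fix u assume u: "u \<in> U \<inter> S"
      show "u \<in> S'"
      proof (cases "u = 0")
        case False
        \<comment> \<open>A nonzero u in \<open>U \<inter> S\<close> spans a point of the linear set
          inside \<open>S\<close>; by \<open>sub\<close> this point also lies in \<open>S'\<close>,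
          and it contains u.\<close>
        then have "F.span {u} \<in> {P \<in> linear_set sF U. P \<subseteq> S}"
          using u S F.span_minimal[of "{u}" S] unfolding linear_set_def by blast
        then show ?thesis using sub F.span_base[of u "{u}"] by blast
      qed (use S' F.subspace_0 in simp)
    qed
    show "S = S'"
    proof (rule ccontr)
      assume "S \<noteq> S'"
      obtain B where B: "B \<subseteq> S \<inter> S'" "F.independent B" "S \<inter> S' \<subseteq> F.span B"
        using F.basis_exists[of "S \<inter> S'"] by metis
      \<comment> \<open>Two independent common vectors would span at least q^(2m) vectors inside
        each of \<open>S\<close> and \<open>S'\<close>, which have exactly that many, so the planes
        would coincide.\<close>
      have "card B < 2"
      proof (rule ccontr)
        assume "\<not> card B < 2"
        then have "m * 2 \<le> m * F.dim (F.span B)"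
          using F.dim_span_eq_card_independent[OF B(2)] by simp
        then have "q ^ (m * 2) \<le> card (F.span B)"
          using cardF[OF F.subspace_span] q by (simp add: power_increasing)
        moreover have "F.span B \<subseteq> S" "F.span B \<subseteq> S'"
          using B S S' by (simp_all add: F.span_minimal)
        ultimately have "F.span B = S" "F.span B = S'"
          using card_seteq[OF fin] cardF S S' by auto
        then show False using \<open>S \<noteq> S'\<close> by simp
      qed
      then have "B = {} \<or> (\<exists>x. B = {x})"
        using fin[of B] card_1_singletonE[of B] by (cases "card B = 0") auto
      \<comment> \<open>If \<open>B\<close> is empty, any x serves, including 0.\<close>
      then obtain x where "B \<subseteq> {x}" by blast
      then have "F.span B \<subseteq> F.span {x}" by (rule F.span_mono)
      then have "U \<inter> S \<subseteq> U \<inter> F.span {x}" using US B by blast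
      then have "card (U \<inter> S) \<le> q ^ h"
        using point[of x] card_mono[OF fin] le_trans by blast
      moreover have "q ^ h < q ^ (h + 1)" using q by (intro power_strict_increasing) auto
      ultimately show False using plane[OF S] by linarith
    qed
  qed simp
  ultimately show ?thesis
    unfolding linear_2_cutting_blocking_set_def using U \<open>F.dim UNIV = n\<close> by blast
qed

end
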